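(* Let $X$ be a finite set and let $S$ be a partition of $X\times X$. Let $\gamma\colon X\otimes S\to X$ be the morphism of $\mathbf{Mat}_{\mathbb R_0^+}$ given by $\gamma_{xa}^y=1$ if $(x,y)\in a$ and $\gamma_{xa}^y=0$ otherwise. Then $\gamma$ is a module over some pointed magma $(S,\nabla,e)$ in $\mathbf{Mat}_{\mathbb R_0^+}$ if and only if $(X,S)$ satisfies both of the following conditions: (CC2) if $p\in S$ and $(x,x)\in p$ for some $x\in X$, then $p\subseteq \mathrm{id}_X=\{(z,z):z\in X\}$; (CC3) for all $a,b,c\in S$ and $(x,y)\in c$, the number of $z\in X$ such that $(x,z)\in a$ and $(z,y)\in b$ does not depend on the choice of $(x,y)\in c$. Moreover, $(S,\nabla,e)$ is then a monoid in $\mathbf{Mat}_{\mathbb R_0^+}$.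
   Context: $\mathbf{Mat}_{\mathbb R_0^+}$ is the category whose objects are finite sets and whose morphisms $f\colon X\to Y$ are matrices $(f_x^y)_{x\in X,y\in Y}$ of non-negative reals, with composition $(g\circ f)_a^c=\sum_{b}f_a^b g_b^c$. It is symmetric monoidal with $X\otimes Y=X\times Y$, $(f\otimes g)_{ac}^{bd}=f_a^b g_c^d$, unit object $I=\{*\}$, and associator, unitors $\lambda_A\colon I\otimes A\to A$, $\rho_A\colon A\otimes I\to A$ and symmetry transferred from the cartesian structure on finite sets (suppressed where evident); a map of finite sets is identified with its $0/1$ matrix. A pointed magma in $\mathbf{Mat}_{\mathbb R_0^+}$ is a triple $(S,\nabla,e)$ with $S$ a finite set, $\nabla\colon S\otimes S\to S$ and $e\colon I\to S$. It is a monoid if $\nabla\circ(e\otimes\mathrm{id}_S)=\lambda_S$, $\nabla\circ(\mathrm{id}_S\otimes e)=\rho_S$ and $\nabla\circ(\nabla\otimes\mathrm{id}_S)=\nabla\circ(\mathrm{id}_S\otimes\nabla)$. A module over a pointed magma $(S,\nabla,e)$ is a finite set $X$ with a morphism $\gamma\colon X\otimes S\to X$ such that $\gamma\circ(\gamma\otimes\mathrm{id}_S)=\gamma\circ(\mathrm{id}_X\otimes\nabla)$ and $\gamma\circ(\mathrm{id}_X\otimes e)=\rho_X$ (the canonical isomorphism $X\otimes I\to X$). *)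

theory Defs
  imports Complex_Main "HOL-Library.Disjoint_Sets"
begin

text \<open>
  The category of finite sets and matrices of non-negative reals. A matrix is a total function
  that vanishes outside its index sets, so that equality of morphisms \<open>X \<rightarrow> Y\<close> is plain HOL
  equality. The object \<open>X \<otimes> Y\<close> is the set \<open>X \<times> Y\<close>.
\<close>

definition mat_hom :: "'a set \<Rightarrow> 'b set \<Rightarrow> ('a \<Rightarrow> 'b \<Rightarrow> real) set" where
  "mat_hom X Y = {f. (\<forall>x\<in>X. \<forall>y\<in>Y. 0 \<le> f x y) \<and> (\<forall>x y. x \<notin> X \<or> y \<notin> Y \<longrightarrow> f x y = 0)}"

text \<open>\<open>g \<circ>\<^bsub>B\<^esub> f\<close> composes \<open>f : A \<rightarrow> B\<close> with \<open>g : B \<rightarrow> C\<close>; only the middle object enters the formula.\<close>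

definition mat_comp :: "('b \<Rightarrow> 'c \<Rightarrow> real) \<Rightarrow> 'b set \<Rightarrow> ('a \<Rightarrow> 'b \<Rightarrow> real) \<Rightarrow> ('a \<Rightarrow> 'c \<Rightarrow> real)"
    ("_ \<circ>\<^bsub>_\<^esub> _" [56, 0, 55] 55) where
  "g \<circ>\<^bsub>B\<^esub> f = (\<lambda>a c. \<Sum>b\<in>B. f a b * g b c)"

definition mat_tensor ::
    "('a \<Rightarrow> 'b \<Rightarrow> real) \<Rightarrow> ('c \<Rightarrow> 'd \<Rightarrow> real) \<Rightarrow> ('a \<times> 'c \<Rightarrow> 'b \<times> 'd \<Rightarrow> real)"
    (infixr "\<otimes>" 70) where
  "f \<otimes> g = (\<lambda>(a, c) (b, d). f a b * g c d)"

text \<open>The \<open>0/1\<close> matrix of a map of finite sets with domain \<open>X\<close>.\<close>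

definition fun_mat :: "'a set \<Rightarrow> ('a \<Rightarrow> 'b) \<Rightarrow> ('a \<Rightarrow> 'b \<Rightarrow> real)" where
  "fun_mat X h = (\<lambda>x y. if x \<in> X \<and> y = h x then 1 else 0)"

definition mat_id :: "'a set \<Rightarrow> ('a \<Rightarrow> 'a \<Rightarrow> real)" where
  "mat_id X = fun_mat X (\<lambda>x. x)"

definition mat_unit :: "unit set" where
  "mat_unit = {()}"

definition mat_lunit :: "'a set \<Rightarrow> (unit \<times> 'a \<Rightarrow> 'a \<Rightarrow> real)" where
  "mat_lunit A = fun_mat (mat_unit \<times> A) snd"

definition mat_runit :: "'a set \<Rightarrow> ('a \<times> unit \<Rightarrow> 'a \<Rightarrow> real)" where
  "mat_runit A = fun_mat (A \<times> mat_unit) fst"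

definition mat_assoc ::
    "'a set \<Rightarrow> 'b set \<Rightarrow> 'c set \<Rightarrow> (('a \<times> 'b) \<times> 'c \<Rightarrow> 'a \<times> ('b \<times> 'c) \<Rightarrow> real)" where
  "mat_assoc A B C = fun_mat ((A \<times> B) \<times> C) (\<lambda>((a, b), c). (a, (b, c)))"

definition pointed_magma ::
    "'s set \<Rightarrow> ('s \<times> 's \<Rightarrow> 's \<Rightarrow> real) \<Rightarrow> (unit \<Rightarrow> 's \<Rightarrow> real) \<Rightarrow> bool" where
  "pointed_magma S m e \<longleftrightarrow> finite S \<and> m \<in> mat_hom (S \<times> S) S \<and> e \<in> mat_hom mat_unit S"

definition mat_monoid ::
    "'s set \<Rightarrow> ('s \<times> 's \<Rightarrow> 's \<Rightarrow> real) \<Rightarrow> (unit \<Rightarrow> 's \<Rightarrow> real) \<Rightarrow> bool" where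
  "mat_monoid S m e \<longleftrightarrow> pointed_magma S m e
     \<and> m \<circ>\<^bsub>S \<times> S\<^esub> (e \<otimes> mat_id S) = mat_lunit S
     \<and> m \<circ>\<^bsub>S \<times> S\<^esub> (mat_id S \<otimes> e) = mat_runit S
     \<and> m \<circ>\<^bsub>S \<times> S\<^esub> (m \<otimes> mat_id S)
         = m \<circ>\<^bsub>S \<times> S\<^esub> ((mat_id S \<otimes> m) \<circ>\<^bsub>S \<times> (S \<times> S)\<^esub> mat_assoc S S S)"

definition magma_module ::
    "'s set \<Rightarrow> ('s \<times> 's \<Rightarrow> 's \<Rightarrow> real) \<Rightarrow> (unit \<Rightarrow> 's \<Rightarrow> real) \<Rightarrow>
     'x set \<Rightarrow> ('x \<times> 's \<Rightarrow> 'x \<Rightarrow> real) \<Rightarrow> bool" where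
  "magma_module S m e X \<gamma> \<longleftrightarrow> finite X \<and> \<gamma> \<in> mat_hom (X \<times> S) X
     \<and> \<gamma> \<circ>\<^bsub>X \<times> S\<^esub> (\<gamma> \<otimes> mat_id S)
         = \<gamma> \<circ>\<^bsub>X \<times> S\<^esub> ((mat_id X \<otimes> m) \<circ>\<^bsub>X \<times> (S \<times> S)\<^esub> mat_assoc X S S)
     \<and> \<gamma> \<circ>\<^bsub>X \<times> S\<^esub> (mat_id X \<otimes> e) = mat_runit X"

definition CC2 :: "'x set \<Rightarrow> ('x \<times> 'x) set set \<Rightarrow> bool" where
  "CC2 X S \<longleftrightarrow> (\<forall>p\<in>S. (\<exists>x\<in>X. (x, x) \<in> p) \<longrightarrow> p \<subseteq> Id_on X)"

definition CC3 :: "'x set \<Rightarrow> ('x \<times> 'x) set set \<Rightarrow> bool" where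
  "CC3 X S \<longleftrightarrow> (\<forall>a\<in>S. \<forall>b\<in>S. \<forall>c\<in>S. \<forall>(x, y)\<in>c. \<forall>(x', y')\<in>c.
     card {z \<in> X. (x, z) \<in> a \<and> (z, y) \<in> b} = card {z \<in> X. (x', z) \<in> a \<and> (z, y') \<in> b})"

end

theory Submission
  imports Defs
begin

text \<open>
  Evaluated at a pair \<open>(x, y)\<close>, a combination \<open>\<Sum>c\<in>S. f c * \<gamma> (x, c) y\<close> is the single coefficient
  \<open>f c\<close> of the class \<open>c\<close> containing \<open>(x, y)\<close>. The two module axioms therefore say exactly that
  \<open>e\<close> is the indicator of the diagonal classes and that \<open>\<nabla>\<close> is given by the intersection numbers
  of CC3, all independently of the representative \<open>(x, y)\<close>. For the same reason \<open>\<gamma>\<close> is a faithful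
  action, so the monoid laws may be checked after letting both sides act on \<open>X\<close>, where they
  become associativity and unitality of composition of endomorphisms of \<open>X\<close>.
\<close>

section \<open>Entries of composites with an identity factor or an associator\<close>

lemma mat_comp_tensor_id_right:
  assumes "finite B"
  shows "(g \<circ>\<^bsub>A \<times> B\<^esub> (f \<otimes> mat_id B)) (a, b) c =
    (if b \<in> B then \<Sum>a'\<in>A. f a a' * g (a', b) c else 0)"
proof -
  have "(g \<circ>\<^bsub>A \<times> B\<^esub> (f \<otimes> mat_id B)) (a, b) c =
      (\<Sum>a'\<in>A. \<Sum>b'\<in>B. f a a' * mat_id B b b' * g (a', b') c)"
    by (simp add: mat_comp_def mat_tensor_def sum.cartesian_product case_prod_unfold)
  also have "\<dots> = (\<Sum>a'\<in>A. \<Sum>b'\<in>B. if b' = b then (if b \<in> B then f a a' * g (a', b) c else 0) else 0)"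
    by (intro sum.cong) (auto simp: mat_id_def fun_mat_def)
  finally show ?thesis
    using assms by (simp)
qed

lemma mat_comp_tensor_id_left:
  assumes "finite A"
  shows "(g \<circ>\<^bsub>A \<times> B\<^esub> (mat_id A \<otimes> f)) (a, b) c =
    (if a \<in> A then \<Sum>b'\<in>B. f b b' * g (a, b') c else 0)"
proof -
  have "(g \<circ>\<^bsub>A \<times> B\<^esub> (mat_id A \<otimes> f)) (a, b) c =
      (\<Sum>a'\<in>A. \<Sum>b'\<in>B. mat_id A a a' * f b b' * g (a', b') c)"
    by (simp add: mat_comp_def mat_tensor_def sum.cartesian_product case_prod_unfold)
  also have "\<dots> = (\<Sum>a'\<in>A. if a' = a then (if a \<in> A then \<Sum>b'\<in>B. f b b' * g (a, b') c else 0) else 0)"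
    by (intro sum.cong) (auto simp: mat_id_def fun_mat_def)
  finally show ?thesis
    using assms by (simp)
qed

lemma mat_comp_assoc_right:
  assumes "finite A" "finite B" "finite C"
  shows "(h \<circ>\<^bsub>A \<times> (B \<times> C)\<^esub> mat_assoc A B C) ((a, b), c) d =
    (if a \<in> A \<and> b \<in> B \<and> c \<in> C then h (a, (b, c)) d else 0)"
proof -
  have "(h \<circ>\<^bsub>A \<times> (B \<times> C)\<^esub> mat_assoc A B C) ((a, b), c) d =
      (\<Sum>p\<in>A \<times> (B \<times> C). if p = (a, (b, c)) then h (a, (b, c)) d else 0)"
    unfolding mat_comp_def by (intro sum.cong) (auto simp: mat_assoc_def fun_mat_def)
  then show ?thesis
    using assms by (simp)
qed

lemma mat_comp_comp: "h \<circ>\<^bsub>C\<^esub> (g \<circ>\<^bsub>B\<^esub> f) = (h \<circ>\<^bsub>C\<^esub> g) \<circ>\<^bsub>B\<^esub> f"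
  unfolding mat_comp_def
  by (intro ext, simp add: sum_distrib_left sum_distrib_right mult.assoc) (rule sum.swap)

section \<open>The module and monoid laws, entry by entry\<close>

text \<open>One criterion for two laws: \<open>l = \<gamma>\<close> gives the associativity axiom of
  a module, and \<open>X = S\<close> with \<open>l = \<gamma> = m\<close> gives associativity of the
  multiplication.\<close>

lemma action_assoc_iff:
  assumes fin: "finite X" "finite S" and g: "\<gamma> \<in> mat_hom (X \<times> S) Y"
    and l: "l \<in> mat_hom (X \<times> S) X" and m: "m \<in> mat_hom (S \<times> S) S"
  shows "\<gamma> \<circ>\<^bsub>X \<times> S\<^esub> (l \<otimes> mat_id S) =
      \<gamma> \<circ>\<^bsub>X \<times> S\<^esub> ((mat_id X \<otimes> m) \<circ>\<^bsub>X \<times> (S \<times> S)\<^esub> mat_assoc X S S) \<longleftrightarrow>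
    (\<forall>x\<in>X. \<forall>a\<in>S. \<forall>b\<in>S. \<forall>y\<in>Y.
      (\<Sum>z\<in>X. l (x, a) z * \<gamma> (z, b) y) = (\<Sum>c\<in>S. m (a, b) c * \<gamma> (x, c) y))"
    (is "?L = ?R \<longleftrightarrow> ?P")
proof -
  have L: "?L ((x, a), b) y = (if b \<in> S then \<Sum>z\<in>X. l (x, a) z * \<gamma> (z, b) y else 0)" for x a b y
    by (rule mat_comp_tensor_id_right[OF fin(2)])
  have R: "?R ((x, a), b) y = (if x \<in> X \<and> a \<in> S \<and> b \<in> S
      then \<Sum>c\<in>S. m (a, b) c * \<gamma> (x, c) y else 0)" for x a b y
    \<comment> \<open>Re-bracketing puts the associator alone on the right, where it merely renames
      the index of the composite of \<open>mat_id X \<otimes> m\<close> and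
      \<open>\<gamma>\<close>.\<close>
    unfolding mat_comp_comp mat_comp_assoc_right[OF fin(1,2,2)]
    by (simp add: mat_comp_tensor_id_left[OF fin(1)])
  show ?thesis
  proof
    assume "?L = ?R"
    then have eq: "?L ((x, a), b) y = ?R ((x, a), b) y" for x a b y
      by simp
    show ?P
    proof (intro ballI)
      fix x a b y assume "x \<in> X" "a \<in> S" "b \<in> S" "y \<in> Y"
      then show "(\<Sum>z\<in>X. l (x, a) z * \<gamma> (z, b) y) = (\<Sum>c\<in>S. m (a, b) c * \<gamma> (x, c) y)"
        using eq[of x a b y] unfolding L R by simp
    qed
  next
    assume P: ?P
    \<comment> \<open>Outside the index sets both sides vanish, since matrices in
      \<open>mat_hom\<close> do.\<close>
    have "?L ((x, a), b) y = ?R ((x, a), b) y" for x a b y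
      unfolding L R using P l g by (cases "y \<in> Y") (auto simp: mat_hom_def)
    then show "?L = ?R"
      by (simp add: fun_eq_iff)
  qed
qed

text \<open>With \<open>X = S\<close> and \<open>\<gamma> = m\<close> this also treats the right
  unit law of a monoid.\<close>

lemma action_runit_iff:
  assumes fin: "finite X" and g: "\<gamma> \<in> mat_hom (X \<times> S) X"
  shows "\<gamma> \<circ>\<^bsub>X \<times> S\<^esub> (mat_id X \<otimes> e) = mat_runit X \<longleftrightarrow>
    (\<forall>x\<in>X. \<forall>y\<in>X. (\<Sum>a\<in>S. e () a * \<gamma> (x, a) y) = of_bool (x = y))"
    (is "?L = _ \<longleftrightarrow> ?P")
proof -
  have L: "?L (x, u) y = (if x \<in> X then \<Sum>a\<in>S. e u a * \<gamma> (x, a) y else 0)" for x u y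
    by (rule mat_comp_tensor_id_left[OF fin])
  have R: "mat_runit X (x, u) y = of_bool (x \<in> X \<and> x = y)" for x y u
    by (auto simp: mat_runit_def fun_mat_def mat_unit_def)
  show ?thesis
  proof
    assume "?L = mat_runit X"
    then have eq: "?L (x, ()) y = mat_runit X (x, ()) y" for x y
      by simp
    show ?P
    proof (intro ballI)
      fix x y assume "x \<in> X" "y \<in> X"
      then show "(\<Sum>a\<in>S. e () a * \<gamma> (x, a) y) = of_bool (x = y)"
        using eq[of x y] unfolding L R by simp
    qed
  next
    assume P: ?P
    have "?L (x, u) y = mat_runit X (x, u) y" for x u y
      unfolding L R using P g by (cases "y \<in> X") (auto simp: mat_hom_def)
    then show "?L = mat_runit X"
      by (simp add: fun_eq_iff)
  qed
qed

text \<open>The left unit law has no counterpart among the module axioms, hence a criterion of its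
  own.\<close>

lemma mult_lunit_iff:
  assumes fin: "finite S" and m: "m \<in> mat_hom (S \<times> S) S"
  shows "m \<circ>\<^bsub>S \<times> S\<^esub> (e \<otimes> mat_id S) = mat_lunit S \<longleftrightarrow>
    (\<forall>b\<in>S. \<forall>c\<in>S. (\<Sum>a\<in>S. e () a * m (a, b) c) = of_bool (b = c))"
    (is "?L = _ \<longleftrightarrow> ?P")
proof -
  have L: "?L (u, b) c = (if b \<in> S then \<Sum>a\<in>S. e u a * m (a, b) c else 0)" for u b c
    by (rule mat_comp_tensor_id_right[OF fin])
  have R: "mat_lunit S (u, b) c = of_bool (b \<in> S \<and> b = c)" for u b c
    by (auto simp: mat_lunit_def fun_mat_def mat_unit_def)
  show ?thesis
  proof
    assume "?L = mat_lunit S"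
    then have eq: "?L ((), b) c = mat_lunit S ((), b) c" for b c
      by simp
    show ?P
    proof (intro ballI)
      fix b c assume "b \<in> S" "c \<in> S"
      then show "(\<Sum>a\<in>S. e () a * m (a, b) c) = of_bool (b = c)"
        using eq[of b c] unfolding L R by simp
    qed
  next
    assume P: ?P
    have "?L (u, b) c = mat_lunit S (u, b) c" for u b c
      unfolding L R using P m by (cases "c \<in> S") (auto simp: mat_hom_def)
    then show "?L = mat_lunit S"
      by (simp add: fun_eq_iff)
  qed
qed

lemma magma_module_iff:
  assumes "pointed_magma S m e" "finite X" "\<gamma> \<in> mat_hom (X \<times> S) X"
  shows "magma_module S m e X \<gamma> \<longleftrightarrow>
    (\<forall>x\<in>X. \<forall>a\<in>S. \<forall>b\<in>S. \<forall>y\<in>X.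
      (\<Sum>z\<in>X. \<gamma> (x, a) z * \<gamma> (z, b) y) = (\<Sum>c\<in>S. m (a, b) c * \<gamma> (x, c) y)) \<and>
    (\<forall>x\<in>X. \<forall>y\<in>X. (\<Sum>a\<in>S. e () a * \<gamma> (x, a) y) = of_bool (x = y))"
  using assms
  by (simp add: magma_module_def pointed_magma_def action_assoc_iff action_runit_iff)

section \<open>Faithful modules force the monoid laws\<close>

text \<open>The assumption \<open>faithful\<close> is linear independence of the matrices by which
  the elements of \<open>S\<close> act on \<open>X\<close>. Each monoid law becomes an identity
  between such matrices, whose coefficients may then be compared.\<close>

lemma faithful_module_imp_monoid:
  assumes magma: "pointed_magma S m e" and module: "magma_module S m e X \<gamma>"
    and faithful: "\<And>f g d. (\<And>x y. x \<in> X \<Longrightarrow> y \<in> X \<Longrightarrow>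
        (\<Sum>c\<in>S. f c * \<gamma> (x, c) y) = (\<Sum>c\<in>S. g c * \<gamma> (x, c) y)) \<Longrightarrow> d \<in> S \<Longrightarrow> f d = g d"
  shows "mat_monoid S m e"
proof -
  have fin: "finite S" "finite X" and m: "m \<in> mat_hom (S \<times> S) S"
    and g: "\<gamma> \<in> mat_hom (X \<times> S) X"
    using magma module by (auto simp: pointed_magma_def magma_module_def)
  have mult: "(\<Sum>c\<in>S. m (a, b) c * \<gamma> (x, c) y) = (\<Sum>z\<in>X. \<gamma> (x, a) z * \<gamma> (z, b) y)"
    if "x \<in> X" "a \<in> S" "b \<in> S" "y \<in> X" for x a b y
    using module that magma_module_iff[OF magma fin(2) g] by simp
  have unit: "(\<Sum>a\<in>S. e () a * \<gamma> (x, a) y) = of_bool (x = y)" if "x \<in> X" "y \<in> X" for x y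
    using module that magma_module_iff[OF magma fin(2) g] by simp
  \<comment> \<open>The map \<open>p\<close> lets the summed element be either factor of the
    product: \<open>p i\<close> is \<open>(i, b)\<close> or \<open>(a, i)\<close> below.\<close>
  have act: "(\<Sum>c\<in>S. (\<Sum>i\<in>S. f i * m (p i) c) * \<gamma> (x, c) y) =
      (\<Sum>i\<in>S. f i * (\<Sum>c\<in>S. m (p i) c * \<gamma> (x, c) y))" for f p x y
    by (simp add: sum_distrib_left sum_distrib_right mult.assoc) (rule sum.swap)
  have act_id: "(\<Sum>c\<in>S. of_bool (b = c) * \<gamma> (x, c) y) = \<gamma> (x, b) y" if "b \<in> S" for b x y
    using fin that by (simp add: of_bool_def if_distrib[of "\<lambda>t. t * _"] cong: if_cong)
  have "(\<Sum>a\<in>S. e () a * m (a, b) d) = of_bool (b = d)" if b: "b \<in> S" and d: "d \<in> S" for b d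
  proof (rule faithful[OF _ d])
    fix x y assume xy: "x \<in> X" "y \<in> X"
    have "(\<Sum>c\<in>S. (\<Sum>a\<in>S. e () a * m (a, b) c) * \<gamma> (x, c) y) =
        (\<Sum>a\<in>S. e () a * (\<Sum>z\<in>X. \<gamma> (x, a) z * \<gamma> (z, b) y))"
      unfolding act using xy b by (intro sum.cong refl) (simp add: mult)
    also have "\<dots> = (\<Sum>z\<in>X. (\<Sum>a\<in>S. e () a * \<gamma> (x, a) z) * \<gamma> (z, b) y)"
      by (simp add: sum_distrib_left sum_distrib_right mult.assoc) (rule sum.swap)
    also have "\<dots> = (\<Sum>z\<in>X. if x = z then \<gamma> (z, b) y else 0)"
      using xy by (intro sum.cong) (simp_all add: unit)
    also have "\<dots> = (\<Sum>c\<in>S. of_bool (b = c) * \<gamma> (x, c) y)"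
      using fin xy b by (simp add: act_id)
    finally show "(\<Sum>c\<in>S. (\<Sum>a\<in>S. e () a * m (a, b) c) * \<gamma> (x, c) y) =
        (\<Sum>c\<in>S. of_bool (b = c) * \<gamma> (x, c) y)" .
  qed
  moreover have "(\<Sum>b\<in>S. e () b * m (a, b) d) = of_bool (a = d)" if a: "a \<in> S" and d: "d \<in> S" for a d
  proof (rule faithful[OF _ d])
    fix x y assume xy: "x \<in> X" "y \<in> X"
    have "(\<Sum>c\<in>S. (\<Sum>b\<in>S. e () b * m (a, b) c) * \<gamma> (x, c) y) =
        (\<Sum>b\<in>S. e () b * (\<Sum>z\<in>X. \<gamma> (x, a) z * \<gamma> (z, b) y))"
      unfolding act using xy a by (intro sum.cong refl) (simp add: mult)
    also have "\<dots> = (\<Sum>z\<in>X. \<gamma> (x, a) z * (\<Sum>b\<in>S. e () b * \<gamma> (z, b) y))"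
      by (simp add: sum_distrib_left mult.left_commute) (rule sum.swap)
    also have "\<dots> = (\<Sum>z\<in>X. if z = y then \<gamma> (x, a) z else 0)"
      using xy by (intro sum.cong) (simp_all add: unit)
    also have "\<dots> = (\<Sum>c\<in>S. of_bool (a = c) * \<gamma> (x, c) y)"
      using fin xy a by (simp add: act_id)
    finally show "(\<Sum>c\<in>S. (\<Sum>b\<in>S. e () b * m (a, b) c) * \<gamma> (x, c) y) =
        (\<Sum>c\<in>S. of_bool (a = c) * \<gamma> (x, c) y)" .
  qed
  moreover have "(\<Sum>f\<in>S. m (a, b) f * m (f, c) d) = (\<Sum>f\<in>S. m (b, c) f * m (a, f) d)"
    if abc: "a \<in> S" "b \<in> S" "c \<in> S" and d: "d \<in> S" for a b c d
  proof (rule faithful[OF _ d])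
    fix x y assume xy: "x \<in> X" "y \<in> X"
    have "(\<Sum>d\<in>S. (\<Sum>f\<in>S. m (a, b) f * m (f, c) d) * \<gamma> (x, d) y) =
        (\<Sum>f\<in>S. m (a, b) f * (\<Sum>z\<in>X. \<gamma> (x, f) z * \<gamma> (z, c) y))"
      unfolding act using xy abc by (intro sum.cong refl) (simp add: mult)
    also have "\<dots> = (\<Sum>z\<in>X. (\<Sum>f\<in>S. m (a, b) f * \<gamma> (x, f) z) * \<gamma> (z, c) y)"
      by (simp add: sum_distrib_left sum_distrib_right mult.assoc) (rule sum.swap)
    also have "\<dots> = (\<Sum>z\<in>X. (\<Sum>w\<in>X. \<gamma> (x, a) w * \<gamma> (w, b) z) * \<gamma> (z, c) y)"
      using xy abc by (intro sum.cong refl) (simp add: mult)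
    \<comment> \<open>Associativity of the matrix product over \<open>X\<close>. The remaining steps
      retrace the earlier ones with the other bracketing.\<close>
    also have "\<dots> = (\<Sum>w\<in>X. \<gamma> (x, a) w * (\<Sum>z\<in>X. \<gamma> (w, b) z * \<gamma> (z, c) y))"
      by (simp add: sum_distrib_left sum_distrib_right mult.assoc) (rule sum.swap)
    also have "\<dots> = (\<Sum>w\<in>X. \<gamma> (x, a) w * (\<Sum>f\<in>S. m (b, c) f * \<gamma> (w, f) y))"
      using xy abc by (intro sum.cong refl) (simp add: mult)
    also have "\<dots> = (\<Sum>f\<in>S. m (b, c) f * (\<Sum>w\<in>X. \<gamma> (x, a) w * \<gamma> (w, f) y))"
      by (simp add: sum_distrib_left mult.left_commute) (rule sum.swap)
    also have "\<dots> = (\<Sum>d\<in>S. (\<Sum>f\<in>S. m (b, c) f * m (a, f) d) * \<gamma> (x, d) y)"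
      unfolding act using xy abc by (intro sum.cong refl) (simp add: mult)
    finally show "(\<Sum>d\<in>S. (\<Sum>f\<in>S. m (a, b) f * m (f, c) d) * \<gamma> (x, d) y) =
        (\<Sum>d\<in>S. (\<Sum>f\<in>S. m (b, c) f * m (a, f) d) * \<gamma> (x, d) y)" .
  qed
  \<comment> \<open>The criteria for actions are now applied to \<open>S\<close> acting on itself by
    \<open>m\<close>.\<close>
  ultimately show ?thesis
    using magma
    by (simp add: mat_monoid_def mult_lunit_iff[OF fin(1) m] action_runit_iff[OF fin(1) m]
        action_assoc_iff[OF fin(1,1) m m m])
qed

section \<open>The action defined by a partition\<close>

text \<open>By disjointness \<open>c\<close> is the only class containing \<open>(x, y)\<close>.
  Reading off coefficients in this way serves both module axioms and faithfulness.\<close>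

lemma partition_action_sum:
  fixes \<gamma> :: "'x \<times> ('x \<times> 'x) set \<Rightarrow> 'x \<Rightarrow> real"
  assumes "finite X" and S: "partition_on (X \<times> X) S"
    and \<gamma>: "\<forall>x\<in>X. \<forall>a\<in>S. \<forall>y\<in>X. \<gamma> (x, a) y = (if (x, y) \<in> a then 1 else 0)"
    and c: "c \<in> S" "(x, y) \<in> c"
  shows "(\<Sum>a\<in>S. f a * \<gamma> (x, a) y) = f c"
proof -
  have xy: "x \<in> X" "y \<in> X"
    using S c by (auto simp: partition_on_def)
  have "(x, y) \<in> a \<longleftrightarrow> a = c" if "a \<in> S" for a
    using S c that by (auto simp: partition_on_def disjoint_def)
  then have "(\<Sum>a\<in>S. f a * \<gamma> (x, a) y) = (\<Sum>a\<in>S. if a = c then f c else 0)"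
    using xy by (intro sum.cong) (simp_all add: \<gamma>)
  moreover have "finite S"
    using finite_elements[OF _ S] \<open>finite X\<close> by simp
  ultimately show ?thesis
    using c by simp
qed

text \<open>Every pair in a class \<open>c\<close> prescribes the same entries
  \<open>m (a, b) c\<close> and \<open>e () c\<close>. Solvability is therefore independence of the
  pair: CC3 for \<open>m\<close>, and CC2 for \<open>e\<close>.\<close>

lemma partition_action_module_iff:
  fixes \<gamma> :: "'x \<times> ('x \<times> 'x) set \<Rightarrow> 'x \<Rightarrow> real"
  assumes X: "finite X" and S: "partition_on (X \<times> X) S" and hom: "\<gamma> \<in> mat_hom (X \<times> S) X"
    and \<gamma>: "\<forall>x\<in>X. \<forall>a\<in>S. \<forall>y\<in>X. \<gamma> (x, a) y = (if (x, y) \<in> a then 1 else 0)"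
    and magma: "pointed_magma S m e"
  shows "magma_module S m e X \<gamma> \<longleftrightarrow>
    (\<forall>c\<in>S. \<forall>x y. (x, y) \<in> c \<longrightarrow>
      (\<forall>a\<in>S. \<forall>b\<in>S. m (a, b) c = card {z \<in> X. (x, z) \<in> a \<and> (z, y) \<in> b})) \<and>
    (\<forall>c\<in>S. \<forall>x y. (x, y) \<in> c \<longrightarrow> e () c = of_bool (x = y))"
proof -
  note sum = partition_action_sum[OF X S \<gamma>]
  have count: "(\<Sum>z\<in>X. \<gamma> (x, a) z * \<gamma> (z, b) y) = card {z \<in> X. (x, z) \<in> a \<and> (z, y) \<in> b}"
    if "x \<in> X" "y \<in> X" "a \<in> S" "b \<in> S" for x y a b
  proof -
    have "(\<Sum>z\<in>X. \<gamma> (x, a) z * \<gamma> (z, b) y) = (\<Sum>z\<in>X. if (x, z) \<in> a \<and> (z, y) \<in> b then 1 else 0)"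
      using that by (intro sum.cong) (auto simp: \<gamma>)
    then show ?thesis
      using X by (simp add: sum.inter_filter[symmetric])
  qed
  \<comment> \<open>The classes cover \<open>X \<times> X\<close>; naming the class of a pair makes
    \<open>sum\<close> applicable.\<close>
  have pairs: "(\<forall>x\<in>X. \<forall>y\<in>X. P x y) \<longleftrightarrow> (\<forall>c\<in>S. \<forall>x y. (x, y) \<in> c \<longrightarrow> P x y)" for P
    using S by (fastforce simp: partition_on_def)
  have in_X: "x \<in> X \<and> y \<in> X" if "c \<in> S" "(x, y) \<in> c" for c x y
    using S that by (auto simp: partition_on_def)
  \<comment> \<open>Quantifying \<open>y\<close> before \<open>a\<close> and \<open>b\<close> gives
    the axiom the shape required by \<open>pairs\<close>.\<close>
  have "magma_module S m e X \<gamma> \<longleftrightarrow>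
    (\<forall>x\<in>X. \<forall>y\<in>X. \<forall>a\<in>S. \<forall>b\<in>S.
      (\<Sum>z\<in>X. \<gamma> (x, a) z * \<gamma> (z, b) y) = (\<Sum>c\<in>S. m (a, b) c * \<gamma> (x, c) y)) \<and>
    (\<forall>x\<in>X. \<forall>y\<in>X. (\<Sum>a\<in>S. e () a * \<gamma> (x, a) y) = of_bool (x = y))"
    unfolding magma_module_iff[OF magma X hom] by blast
  also have "\<dots> \<longleftrightarrow>
    (\<forall>c\<in>S. \<forall>x y. (x, y) \<in> c \<longrightarrow>
      (\<forall>a\<in>S. \<forall>b\<in>S. m (a, b) c = card {z \<in> X. (x, z) \<in> a \<and> (z, y) \<in> b})) \<and>
    (\<forall>c\<in>S. \<forall>x y. (x, y) \<in> c \<longrightarrow> e () c = of_bool (x = y))"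
    unfolding pairs
    by (intro arg_cong2[where f = "(\<and>)"] ball_cong all_cong1 imp_cong refl)
      (auto simp: sum count in_X intro: sym)
  finally show ?thesis .
qed

section \<open>The equivalence with CC2 and CC3\<close>

lemma CC3D:
  assumes "CC3 X S" "a \<in> S" "b \<in> S" "c \<in> S" "(x, y) \<in> c" "(x', y') \<in> c"
  shows "card {z \<in> X. (x, z) \<in> a \<and> (z, y) \<in> b} = card {z \<in> X. (x', z) \<in> a \<and> (z, y') \<in> b}"
proof -
  have "\<forall>(x, y)\<in>c. \<forall>(x', y')\<in>c.
      card {z \<in> X. (x, z) \<in> a \<and> (z, y) \<in> b} = card {z \<in> X. (x', z) \<in> a \<and> (z, y') \<in> b}"
    using assms(1-4) unfolding CC3_def by simp
  from bspec[OF bspec[OF this assms(5), simplified] assms(6)] show ?thesis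
    by simp
qed

text \<open>Classes are nonempty, so \<open>partition_action_module_iff\<close> determines
  \<open>m\<close> and \<open>e\<close>: the second conjunct concerns at most one magma.\<close>

theorem theorem3p1:
  fixes X :: "'x set" and S :: "('x \<times> 'x) set set"
    and \<gamma> :: "'x \<times> ('x \<times> 'x) set \<Rightarrow> 'x \<Rightarrow> real"
  assumes "finite X"
    and "partition_on (X \<times> X) S"
    and "\<gamma> \<in> mat_hom (X \<times> S) X"
    and "\<And>x a y. x \<in> X \<Longrightarrow> a \<in> S \<Longrightarrow> y \<in> X \<Longrightarrow> \<gamma> (x, a) y = (if (x, y) \<in> a then 1 else 0)"
  shows "((\<exists>m e. pointed_magma S m e \<and> magma_module S m e X \<gamma>) \<longleftrightarrow> CC2 X S \<and> CC3 X S)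
    \<and> (\<forall>m e. pointed_magma S m e \<and> magma_module S m e X \<gamma> \<longrightarrow> mat_monoid S m e)"
proof (intro conjI iffI allI impI)
  have \<gamma>: "\<forall>x\<in>X. \<forall>a\<in>S. \<forall>y\<in>X. \<gamma> (x, a) y = (if (x, y) \<in> a then 1 else 0)"
    using assms(4) by blast
  note module_iff = partition_action_module_iff[OF assms(1-3) \<gamma>]
  note S = assms(2)
  have in_X: "x \<in> X \<and> y \<in> X" if "c \<in> S" "(x, y) \<in> c" for c x y
    using S that by (auto simp: partition_on_def)
  have rep: "\<exists>x y. (x, y) \<in> c" if "c \<in> S" for c
    using S that by (metis partition_on_def ex_in_conv surj_pair)
  {
    assume "\<exists>m e. pointed_magma S m e \<and> magma_module S m e X \<gamma>"
    then obtain m e where magma: "pointed_magma S m e" and module: "magma_module S m e X \<gamma>"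
      by blast
    have m: "m (a, b) c = card {z \<in> X. (x, z) \<in> a \<and> (z, y) \<in> b}"
      if "a \<in> S" "b \<in> S" "c \<in> S" "(x, y) \<in> c" for a b c x y
      using module that by (simp add: module_iff[OF magma])
    have e: "e () c = of_bool (x = y)" if "c \<in> S" "(x, y) \<in> c" for c x y
      using module that by (simp add: module_iff[OF magma])
    show "CC2 X S"
      unfolding CC2_def
    proof (intro ballI impI subrelI)
      fix p u v assume p: "p \<in> S" "\<exists>x\<in>X. (x, x) \<in> p" and uv: "(u, v) \<in> p"
      obtain x where "(x, x) \<in> p"
        using p(2) by blast
      \<comment> \<open>The diagonal pair gives \<open>e () p = 1\<close>, and \<open>(u, v)\<close>
        gives the same entry as \<open>of_bool (u = v)\<close>.\<close>
      then have "of_bool (u = v) = (1 :: real)"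
        using e[OF p(1)] e[OF p(1) uv] by fastforce
      then show "(u, v) \<in> Id_on X"
        using in_X[OF p(1) uv] by (auto split: if_splits)
    qed
    show "CC3 X S"
      unfolding CC3_def
    proof (intro ballI, clarify)
      fix a b c x y x' y' assume "a \<in> S" "b \<in> S" "c \<in> S" "(x, y) \<in> c" "(x', y') \<in> c"
      \<comment> \<open>As reals, both cardinalities equal the entry
        \<open>m (a, b) c\<close>.\<close>
      then show "card {z \<in> X. (x, z) \<in> a \<and> (z, y) \<in> b} =
          card {z \<in> X. (x', z) \<in> a \<and> (z, y') \<in> b}"
        using m[of a b c x y] m[of a b c x' y'] by linarith
    qed
  next
    assume CC: "CC2 X S \<and> CC3 X S"
    \<comment> \<open>\<open>(rx c, ry c)\<close> is a chosen pair of the class \<open>c\<close>, at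
      which its intersection numbers are counted.\<close>
    define rx ry where "rx c = fst (SOME p. p \<in> c)" and "ry c = snd (SOME p. p \<in> c)"
      for c :: "('x \<times> 'x) set"
    have r: "(rx c, ry c) \<in> c" if "c \<in> S" for c
      using rep[OF that] unfolding rx_def ry_def prod.collapse by (auto intro: someI)
    \<comment> \<open>The default \<open>0\<close> off \<open>S\<close> is what membership in
      \<open>mat_hom\<close> demands.\<close>
    define m :: "('x \<times> 'x) set \<times> ('x \<times> 'x) set \<Rightarrow> ('x \<times> 'x) set \<Rightarrow> real" where
      "m = (\<lambda>(a, b) c. if a \<in> S \<and> b \<in> S \<and> c \<in> S
        then card {z \<in> X. (rx c, z) \<in> a \<and> (z, ry c) \<in> b} else 0)"
    define e :: "unit \<Rightarrow> ('x \<times> 'x) set \<Rightarrow> real" where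
      "e = (\<lambda>_ c. of_bool (c \<in> S \<and> c \<subseteq> Id_on X))"
    have "finite S"
      using finite_elements[OF _ S] assms(1) by simp
    then have magma: "pointed_magma S m e"
      by (auto simp: pointed_magma_def mat_hom_def m_def e_def mat_unit_def)
    have "m (a, b) c = card {z \<in> X. (x, z) \<in> a \<and> (z, y) \<in> b}"
      if "a \<in> S" "b \<in> S" "c \<in> S" "(x, y) \<in> c" for a b c x y
    proof -
      have "card {z \<in> X. (rx c, z) \<in> a \<and> (z, ry c) \<in> b} =
          card {z \<in> X. (x, z) \<in> a \<and> (z, y) \<in> b}"
        using CC r[OF that(3)] that by (intro CC3D) simp_all
      then show ?thesis
        using that by (simp add: m_def)
    qed
    \<comment> \<open>By CC2 a class containing one diagonal pair lies in the diagonal; an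
      off-diagonal pair rules this out.\<close>
    moreover have "e () c = of_bool (x = y)" if "c \<in> S" "(x, y) \<in> c" for c x y
      using CC that in_X[OF that] unfolding CC2_def e_def by auto
    ultimately have "magma_module S m e X \<gamma>"
      by (simp add: module_iff[OF magma])
    with magma show "\<exists>m e. pointed_magma S m e \<and> magma_module S m e X \<gamma>"
      by blast
  next
    fix m e assume module: "pointed_magma S m e \<and> magma_module S m e X \<gamma>"
    show "mat_monoid S m e"
    proof (rule faithful_module_imp_monoid[OF conjunct1[OF module] conjunct2[OF module]])
      fix f g :: "('x \<times> 'x) set \<Rightarrow> real" and d
      assume eq: "\<And>x y. x \<in> X \<Longrightarrow> y \<in> X \<Longrightarrow>
          (\<Sum>c\<in>S. f c * \<gamma> (x, c) y) = (\<Sum>c\<in>S. g c * \<gamma> (x, c) y)"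
        and d: "d \<in> S"
      \<comment> \<open>Evaluation at any pair of \<open>d\<close> isolates the coefficients at
        \<open>d\<close>.\<close>
      from rep[OF d] obtain x y where xy: "(x, y) \<in> d"
        by blast
      then show "f d = g d"
        using eq[of x y] in_X[OF d xy] by (simp add: partition_action_sum[OF assms(1,2) \<gamma> d xy])
    qed
  }
qed

end
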